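(* Let $C(p)$, $K(p)$, $L(p)$, $G(p)$, $s(n,r)$ and $B(p)$ be as defined in the context. For every even $p=2m$, $m=2,3,4,\ldots$, $$K(2m)=\sum_{l=0}^{2m}(-1)^l\binom{2m}{l}\sum_{q=0}^{2m-l}\sum_{r=0}^{l}2^{-r-q}\,s(2m-l,q)\,s(l,r),$$ $$C(2m)^{2m}=L(2m)=\sum_{l=0}^{2m}(-1)^l\binom{2m}{l}\sum_{r=0}^{2m-l}s(2m-l,r).$$ For every odd integer $p=5,7,9,\ldots$, $$G(p)^p=L(p)=\frac{2}{e}+\sum_{k=0}^{p}(-1)^k\binom{p}{k}B(p-k).$$
   Context: For a random variable $\xi$ write $\|\xi\|_p=(\mathbf{E}|\xi|^p)^{1/p}$. For real $p\ge 2$, $$C(p)=\sup_{\{\xi(i)\}}\sup_{n}\frac{\|\sum_{i=1}^n\xi(i)\|_p}{\max\left(\|\sum_{i=1}^n\xi(i)\|_2,\ (\sum_{i=1}^n\|\xi(i)\|_p^p)^{1/p}\right)},$$ where the outer supremum is over all sequences of independent centered ($\mathbf{E}\xi(i)=0$) real random variables with $\|\xi(i)\|_p<\infty$ for all $i$. $S(p)$ is defined by the same formula, with the supremum restricted to sequences of independent symmetrically distributed random variables with $\|\xi(i)\|_p<\infty$, and $K(p)=S(p)^p$. For real $p\ge4$, $L(p)=\mathbf{E}|\theta-1|^p=e^{-1}\sum_{n=0}^\infty|n-1|^p/n!$, where $\theta$ is Poisson with parameter $1$, and $G(p)=L(p)^{1/p}$. $s(n,r)$ are the Stirling numbers of the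 second kind: $x^n=\sum_{r=0}^n s(n,r)\,x_{(r)}$, where $x_{(r)}=x(x-1)\cdots(x-r+1)$ and $x_{(0)}=1$. $B(p)$ are the Bell numbers: $B(0)=1$ and $B(p)=e^{-1}\sum_{n=1}^\infty n^p/n!$ for $p>0$. *)

theory Defs
  imports "HOL-Probability.Probability" "HOL-Combinatorics.Stirling"
begin

definition lp_norm :: "'a measure \<Rightarrow> real \<Rightarrow> ('a \<Rightarrow> real) \<Rightarrow> real"
  where "lp_norm M p X = (\<integral>\<omega>. \<bar>X \<omega>\<bar> powr p \<partial>M) powr (1 / p)"

definition indep_lp_seq :: "'a measure \<Rightarrow> real \<Rightarrow> (nat \<Rightarrow> 'a \<Rightarrow> real) \<Rightarrow> bool"
  where "indep_lp_seq M p \<xi> \<longleftrightarrow>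
    prob_space M \<and> prob_space.indep_vars M (\<lambda>_. borel) \<xi> UNIV \<and>
    (\<forall>i. integrable M (\<lambda>\<omega>. \<bar>\<xi> i \<omega>\<bar> powr p))"

definition centered_seq :: "'a measure \<Rightarrow> (nat \<Rightarrow> 'a \<Rightarrow> real) \<Rightarrow> bool"
  where "centered_seq M \<xi> \<longleftrightarrow> (\<forall>i. integrable M (\<xi> i) \<and> (\<integral>\<omega>. \<xi> i \<omega> \<partial>M) = 0)"

definition symmetric_seq :: "'a measure \<Rightarrow> (nat \<Rightarrow> 'a \<Rightarrow> real) \<Rightarrow> bool"
  where "symmetric_seq M \<xi> \<longleftrightarrow> (\<forall>i. distr M borel (\<xi> i) = distr M borel (\<lambda>\<omega>. - \<xi> i \<omega>))"

(* If the denominator vanishes, then all summands are a.s. zero; the value 0/0 = 0 then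
   does not affect the suprema below. *)
definition rosenthal_ratio :: "'a measure \<Rightarrow> real \<Rightarrow> (nat \<Rightarrow> 'a \<Rightarrow> real) \<Rightarrow> nat \<Rightarrow> real"
  where "rosenthal_ratio M p \<xi> n =
    lp_norm M p (\<lambda>\<omega>. \<Sum>i<n. \<xi> i \<omega>) /
    max (lp_norm M 2 (\<lambda>\<omega>. \<Sum>i<n. \<xi> i \<omega>)) ((\<Sum>i<n. lp_norm M p (\<xi> i) powr p) powr (1 / p))"

(* Sample spaces of type nat => real lose no generality, since the joint law of any sequence of
   real random variables is a measure on that type; see rosenthal_ratio_le_C and
   rosenthal_ratio_le_S. Suprema are taken in ereal so that finiteness is not built in. *)
definition rosenthal_C :: "real \<Rightarrow> ereal"
  where "rosenthal_C p =
    (SUP (M, \<xi>) \<in> {(M :: (nat \<Rightarrow> real) measure, \<xi>). indep_lp_seq M p \<xi> \<and> centered_seq M \<xi>}.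
       SUP n \<in> {1..}. ereal (rosenthal_ratio M p \<xi> n))"

definition rosenthal_S :: "real \<Rightarrow> ereal"
  where "rosenthal_S p =
    (SUP (M, \<xi>) \<in> {(M :: (nat \<Rightarrow> real) measure, \<xi>). indep_lp_seq M p \<xi> \<and> symmetric_seq M \<xi>}.
       SUP n \<in> {1..}. ereal (rosenthal_ratio M p \<xi> n))"

definition ereal_powr :: "ereal \<Rightarrow> real \<Rightarrow> ereal"
  where "ereal_powr x p = (if x = \<infinity> then \<infinity> else ereal (real_of_ereal x powr p))"

definition rosenthal_K :: "real \<Rightarrow> ereal"
  where "rosenthal_K p = ereal_powr (rosenthal_S p) p"

definition poisson_L :: "real \<Rightarrow> real"
  where "poisson_L p = measure_pmf.expectation (poisson_pmf 1) (\<lambda>n. \<bar>real n - 1\<bar> powr p)"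

definition poisson_G :: "real \<Rightarrow> real"
  where "poisson_G p = poisson_L p powr (1 / p)"

definition bell :: "nat \<Rightarrow> real"
  where "bell p = (if p = 0 then 1 else exp (-1) * (\<Sum>n. real (Suc n) ^ p / fact (Suc n)))"

(* The Stirling numbers of the second kind satisfy the falling factorial expansion. *)
lemma power_eq_sum_Stirling:
  fixes x :: real
  shows "x ^ n = (\<Sum>r\<le>n. real (Stirling n r) * (\<Prod>j<r. x - real j))"
proof (induction n)
  case 0
  show ?case by simp
next
  case (Suc n)
  let ?f = "\<lambda>r. \<Prod>j<r. x - real j"
  have step: "x * ?f r = ?f (Suc r) + real r * ?f r" for r
    by (simp add: algebra_simps)
  have "(\<Sum>r\<le>Suc n. real (Stirling (Suc n) r) * ?f r)
      = (\<Sum>r\<le>n. real (Stirling (Suc n) (Suc r)) * ?f (Suc r))"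
    by (subst sum.atMost_Suc_shift) simp
  also have "\<dots> = (\<Sum>r\<le>n. real (Suc r) * real (Stirling n (Suc r)) * ?f (Suc r))
                 + (\<Sum>r\<le>n. real (Stirling n r) * ?f (Suc r))"
    by (simp add: sum.distrib[symmetric] algebra_simps del: prod.lessThan_Suc)
  also have "(\<Sum>r\<le>n. real (Suc r) * real (Stirling n (Suc r)) * ?f (Suc r))
      = (\<Sum>r\<le>Suc n. real r * real (Stirling n r) * ?f r)"
    by (simp only: sum.atMost_Suc_shift[of _ n] mult_zero_left of_nat_0 add_0_left)
  also have "\<dots> = (\<Sum>r\<le>n. real r * real (Stirling n r) * ?f r)"
    by simp
  also have "(\<Sum>r\<le>n. real r * real (Stirling n r) * ?f r) + (\<Sum>r\<le>n. real (Stirling n r) * ?f (Suc r))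
      = (\<Sum>r\<le>n. real (Stirling n r) * (x * ?f r))"
    unfolding step by (simp add: sum.distrib[symmetric] algebra_simps del: prod.lessThan_Suc)
  also have "\<dots> = x * x ^ n"
    by (subst Suc.IH) (simp add: sum_distrib_left algebra_simps)
  finally show ?case by simp
qed

lemma summable_power_div_fact: "summable (\<lambda>n. real n ^ k / fact n)"
proof (rule summable_comparison_test_ev)
  have "(\<lambda>n. real n ^ k / 2 ^ n) \<longlonglongrightarrow> 0"
    by real_asymp
  then have "\<forall>\<^sub>F n in sequentially. real n ^ k / 2 ^ n < 1"
    by (rule order_tendstoD) simp
  then show "\<forall>\<^sub>F n in sequentially. norm (real n ^ k / fact n) \<le> 2 ^ n / fact n"
    by eventually_elim (simp add: field_simps divide_right_mono)
  show "summable (\<lambda>n. 2 ^ n / fact n :: real)"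
    using summable_exp[of "2::real"] by (simp add: field_simps)
qed

lemma poisson_L_sums:
  assumes "p \<ge> 0"
  shows "(\<lambda>n. exp (-1) * (\<bar>real n - 1\<bar> powr p / fact n)) sums poisson_L p"
proof -
  define k where "k = nat \<lceil>p\<rceil>"
  let ?g = "\<lambda>n. pmf (poisson_pmf 1) n * \<bar>real n - 1\<bar> powr p"
  have g: "?g n = exp (-1) * (\<bar>real n - 1\<bar> powr p / fact n)" for n
    by (simp add: field_simps)
  have "\<bar>real n - 1\<bar> powr p \<le> 1 + real n ^ k" for n
  proof (cases "n \<ge> 2")
    case True
    have "\<bar>real n - 1\<bar> powr p \<le> real n powr p"
      using True assms by (intro powr_mono2) auto
    also have "\<dots> \<le> real n powr real k"
      using True by (intro powr_mono) (auto simp: k_def real_nat_ceiling_ge)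
    finally show ?thesis using True by (simp add: powr_realpow)
  next
    case False
    then have "n = 0 \<or> n = 1" by auto
    then show ?thesis by auto
  qed
  then have le: "norm (\<bar>real n - 1\<bar> powr p / fact n) \<le> real n ^ 0 / fact n + real n ^ k / fact n" for n
    by (simp add: divide_right_mono add_divide_distrib[symmetric])
  have "summable (\<lambda>n. \<bar>real n - 1\<bar> powr p / fact n)"
    by (rule summable_comparison_test'[OF summable_add[OF summable_power_div_fact[of 0]
          summable_power_div_fact[of k]]]) (rule le)
  then have sm: "summable ?g"
    unfolding g by (rule summable_mult)
  have int: "integrable (count_space UNIV) ?g"
    using sm by (subst integrable_count_space_nat_iff) simp
  have "poisson_L p = integral\<^sup>L (count_space UNIV) ?g"
    unfolding poisson_L_def
    by (subst measure_pmf_eq_density, subst integral_density) auto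
  with sums_integral_count_space_nat[OF int] show ?thesis
    unfolding g by simp
qed

context
  fixes M :: "'a measure" and p :: real and \<xi> :: "nat \<Rightarrow> 'a \<Rightarrow> real"
  assumes seq: "indep_lp_seq M p \<xi>"
begin

private definition joint_law :: "(nat \<Rightarrow> real) measure"
  where "joint_law = distr M (PiM UNIV (\<lambda>_. borel)) (\<lambda>\<omega> i. \<xi> i \<omega>)"

private lemma rv [measurable]: "\<xi> i \<in> borel_measurable M"
  using seq by (auto simp: indep_lp_seq_def prob_space.indep_vars_def2)

private lemma joint_rv [measurable]: "(\<lambda>\<omega> i. \<xi> i \<omega>) \<in> M \<rightarrow>\<^sub>M PiM UNIV (\<lambda>_. borel)"
  by (rule measurable_PiM_single') auto

private lemma sets_joint_law [measurable_cong]: "sets joint_law = sets (PiM UNIV (\<lambda>_. borel))"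
  by (simp add: joint_law_def)

private lemma integral_joint_law:
  assumes "f \<in> borel_measurable (PiM UNIV (\<lambda>_. borel))"
  shows "(\<integral>x. f x \<partial>joint_law) = (\<integral>\<omega>. (f (\<lambda>i. \<xi> i \<omega>) :: real) \<partial>M)"
    and "integrable joint_law f \<longleftrightarrow> integrable M (\<lambda>\<omega>. f (\<lambda>i. \<xi> i \<omega>))"
  using assms unfolding joint_law_def by (simp_all add: integral_distr integrable_distr_eq)

private lemma distr_joint_law:
  assumes "f \<in> borel_measurable (PiM UNIV (\<lambda>_. borel))"
  shows "distr joint_law borel f = distr M borel (\<lambda>\<omega>. f (\<lambda>i. \<xi> i \<omega>) :: real)"
  using assms unfolding joint_law_def by (subst distr_distr) (auto simp: o_def)

private lemma indep_lp_seq_joint_law: "indep_lp_seq joint_law p (\<lambda>i x. x i)"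
proof -
  interpret M: prob_space M using seq by (simp add: indep_lp_seq_def)
  interpret J: prob_space joint_law unfolding joint_law_def by (rule M.prob_space_distr) simp
  have "M.indep_vars (\<lambda>_. borel) \<xi> UNIV"
    using seq by (simp add: indep_lp_seq_def)
  then have "joint_law = PiM UNIV (\<lambda>i. distr M borel (\<xi> i))"
    by (subst (asm) M.indep_vars_iff_distr_eq_PiM) (auto simp: joint_law_def restrict_def)
  moreover have "distr joint_law (PiM UNIV (\<lambda>_. borel)) (\<lambda>x. x) = joint_law"
    by (rule distr_id2) (simp add: sets_joint_law)
  moreover have "distr joint_law borel (\<lambda>x. x i) = distr M borel (\<xi> i)" for i
    by (rule distr_joint_law) simp
  ultimately have "J.indep_vars (\<lambda>_. borel) (\<lambda>i x. x i) UNIV"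
    by (subst J.indep_vars_iff_distr_eq_PiM) (auto simp: restrict_def)
  moreover have "integrable joint_law (\<lambda>x. \<bar>x i\<bar> powr p)" for i
    using seq by (subst integral_joint_law) (auto simp: indep_lp_seq_def)
  ultimately show ?thesis
    using J.prob_space_axioms by (simp add: indep_lp_seq_def)
qed

private lemma ratio_joint_law:
  "rosenthal_ratio joint_law p (\<lambda>i x. x i) n = rosenthal_ratio M p \<xi> n"
  unfolding rosenthal_ratio_def lp_norm_def by (subst (1 2 3) integral_joint_law) auto

lemma rosenthal_ratio_le_C:
  assumes "centered_seq M \<xi>" "n \<ge> 1"
  shows "ereal (rosenthal_ratio M p \<xi> n) \<le> rosenthal_C p"
proof -
  have "centered_seq joint_law (\<lambda>i x. x i)"
    using assms(1) unfolding centered_seq_def by (simp add: integral_joint_law)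
  then show ?thesis
    using indep_lp_seq_joint_law assms(2) unfolding rosenthal_C_def ratio_joint_law[symmetric]
    by (intro SUP_upper2[of "(joint_law, \<lambda>i x. x i)"]) (auto intro: SUP_upper)
qed

lemma rosenthal_ratio_le_S:
  assumes "symmetric_seq M \<xi>" "n \<ge> 1"
  shows "ereal (rosenthal_ratio M p \<xi> n) \<le> rosenthal_S p"
proof -
  have "symmetric_seq joint_law (\<lambda>i x. x i)"
    using assms(1) unfolding symmetric_seq_def by (simp add: distr_joint_law)
  then show ?thesis
    using indep_lp_seq_joint_law assms(2) unfolding rosenthal_S_def ratio_joint_law[symmetric]
    by (intro SUP_upper2[of "(joint_law, \<lambda>i x. x i)"]) (auto intro: SUP_upper)
qed

end

end

theory Submission
  imports Defs "HOL-Computational_Algebra.Formal_Power_Series"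
begin

text \<open>
  Both constants rest on one recursion. If \<open>S\<close> is a finite sum of independent variables \<open>X i\<close>, then
  writing one factor of \<open>S ^ (N + 1)\<close> as \<open>\<Sum>i. X i\<close> and expanding \<open>S ^ N\<close> around the sum \<open>S - X i\<close>,
  which is independent of \<open>X i\<close>, gives
  \[ E S^{N+1} = \sum_k {N \choose k} \sum_i E X_i^{k+1} \, E (S - X_i)^{N-k}. \]
  This resembles the recursion \<open>m (N + 1) = (\<Sum>k. (N choose k) * c (k + 1) * m (N - k))\<close> that yields the
  moments of a law from its cumulants \<open>c\<close>, with \<open>\<Sum>i. E (X i ^ k)\<close> in the role of \<open>c k\<close>; the only
  difference is the removed summand.

  Upper bound. Normalise the denominator of the ratio to \<open>1\<close>, so that \<open>\<Sum>i. E (X i ^ 2) \<le> 1\<close> and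
  \<open>\<Sum>i. E (X i ^ p) \<le> 1\<close>. As \<open>y ^ k\<close> is dominated by a convex combination of \<open>y ^ 2\<close> and \<open>y ^ p\<close>, all
  sums \<open>\<Sum>i. E \<bar>X i\<bar> ^ k\<close> with \<open>2 \<le> k \<le> p\<close> are at most \<open>1\<close> as well. In the centered case the first
  moments vanish and in the symmetric case all odd ones do, so an induction along the recursion
  (\<open>abs_expectation_sum_power_le\<close>) bounds \<open>E S ^ p\<close> by the moment of the law with all cumulants
  from the second on equal to \<open>1\<close>, respectively with even cumulants \<open>1\<close> and odd cumulants \<open>0\<close>. These
  are the laws of \<open>\<theta> - 1\<close> for a Poisson variable \<open>\<theta>\<close> of parameter \<open>1\<close> and of \<open>\<theta>1 - \<theta>2\<close> for
  independent Poisson variables of parameter \<open>1/2\<close>.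

  Sharpness. For sums of \<open>n\<close> i.i.d. variables that are centered Bernoulli variables of parameter \<open>1/n\<close>, or
  take the values \<open>1\<close> and \<open>-1\<close> with probability \<open>1/(2n)\<close> each, both quantities in the denominator tend
  to \<open>1\<close>, and \<open>n * E (X ^ k)\<close> tends to the extremal cumulants; by the recursion again the moments
  of the sum converge to the extremal ones (\<open>iid_sum_moment_tendsto\<close>).

  Closed forms. Cumulants are additive (\<open>cumulant_moment_add\<close>, the product rule for exponential
  generating functions), and the moments of a Poisson law are the Touchard polynomials
  (\<open>Touchard_eq_cumulant_moment\<close>); the alternating sums in the theorem are the binomial convolutions
  for \<open>\<theta> - 1\<close> and \<open>\<theta>1 - \<theta>2\<close>. For odd \<open>p\<close>, \<open>\<bar>n - 1\<bar> ^ p\<close> differs from \<open>(n - 1) ^ p\<close> only at \<open>n = 0\<close>,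
  which accounts for the term \<open>2 / e\<close>.
\<close>

section \<open>Moments determined by cumulants\<close>

text \<open>
  The recursion between moments and cumulants of a law, for arbitrary sequences \<open>c\<close>, which need not
  be the cumulants of any law. Combinatorially this sums \<open>\<Prod>B\<in>\<pi>. c (card B)\<close> over the set partitions \<open>\<pi>\<close> of an
  \<open>N\<close>-element set, \<open>k + 1\<close> being the size of the block of a distinguished element.
\<close>
fun cumulant_moment :: "(nat \<Rightarrow> real) \<Rightarrow> nat \<Rightarrow> real" where
  "cumulant_moment c 0 = 1"
| "cumulant_moment c (Suc N) =
     (\<Sum>k\<le>N. real (N choose k) * c (Suc k) * cumulant_moment c (N - k))"

lemma cumulant_moment_nonneg:
  assumes "\<And>k. k \<ge> 1 \<Longrightarrow> c k \<ge> 0"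
  shows "cumulant_moment c N \<ge> 0"
proof (induction N rule: less_induct)
  case (less N)
  then show ?case
    by (cases N) (auto intro!: sum_nonneg mult_nonneg_nonneg assms)
qed

lemma cumulant_moment_unique:
  assumes "m 0 = 1"
    and "\<And>N. m (Suc N) = (\<Sum>k\<le>N. real (N choose k) * c (Suc k) * m (N - k))"
  shows "m N = cumulant_moment c N"
proof (induction N rule: less_induct)
  case (less N)
  then show ?case
    by (cases N) (auto simp: assms intro!: sum.cong)
qed

text \<open>
  Scaling a random variable by \<open>a\<close> multiplies its \<open>k\<close>-th cumulant and moment by \<open>a ^ k\<close>. Used with
  \<open>a = -1\<close> for reflection and with the denominator of the ratio for normalisation.
\<close>
lemma cumulant_moment_scale:
  "cumulant_moment (\<lambda>k. a ^ k * c k) N = a ^ N * cumulant_moment c N"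
proof (rule cumulant_moment_unique[symmetric])
  fix N
  have "a ^ Suc N = a ^ Suc k * a ^ (N - k)" if "k \<le> N" for k
    using that by (simp flip: power_add)
  then show "a ^ Suc N * cumulant_moment c (Suc N) =
      (\<Sum>k\<le>N. real (N choose k) * (a ^ Suc k * c (Suc k)) * (a ^ (N - k) * cumulant_moment c (N - k)))"
    by (simp add: sum_distrib_left mult_ac del: power_Suc cong: sum.cong_simp)
qed simp

text \<open>
  The left side is the moment of a sum of independent variables with cumulants \<open>c\<close> and \<open>d\<close>. If \<open>F c\<close>
  is the exponential generating function of the moments, the recursion says \<open>F c' = K c * F c\<close> where \<open>K c\<close>
  is the derivative of the cumulant generating function. Hence \<open>F c * F d\<close> solves the same equation for
  \<open>K c + K d\<close>, and solutions with constant term \<open>1\<close> are unique.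
\<close>
lemma cumulant_moment_add:
  "(\<Sum>l\<le>N. real (N choose l) * cumulant_moment c (N - l) * cumulant_moment d l) =
     cumulant_moment (\<lambda>k. c k + d k) N"
proof -
  define F where "F e = Abs_fps (\<lambda>n. cumulant_moment e n / fact n)" for e
  define K where "K e = Abs_fps (\<lambda>n. e (Suc n) / fact n)" for e :: "nat \<Rightarrow> real"
  have F_nth: "fps_nth (F e) n = cumulant_moment e n / fact n" for e n
    by (simp add: F_def)
  have K_nth: "fps_nth (K e) n = e (Suc n) / fact n" for e n
    by (simp add: K_def)
  have binom: "real (n choose k) = fact n / (fact k * fact (n - k))" if "k \<le> n" for n k
    using that by (rule binomial_fact)
  have F_deriv: "fps_deriv (F e) = K e * F e" for e
  proof (rule fps_ext)
    fix n
    have "fps_nth (fps_deriv (F e)) n = cumulant_moment e (Suc n) / fact n"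
      unfolding fps_deriv_nth F_nth Suc_eq_plus1[symmetric] fact_Suc
      by (simp del: cumulant_moment.simps of_nat_Suc)
    also have "\<dots> = (\<Sum>k\<le>n. (e (Suc k) / fact k) * (cumulant_moment e (n - k) / fact (n - k)))"
      unfolding cumulant_moment.simps sum_divide_distrib
      by (intro sum.cong refl) (simp add: binom)
    also have "\<dots> = fps_nth (K e * F e) n"
      unfolding fps_mult_nth F_nth K_nth atLeast0AtMost ..
    finally show "fps_nth (fps_deriv (F e)) n = fps_nth (K e * F e) n" .
  qed
  define P where "P = F c * F d"
  have "K (\<lambda>k. c k + d k) = K c + K d"
    by (rule fps_ext) (simp add: K_nth add_divide_distrib)
  then have P_deriv: "fps_deriv P = K (\<lambda>k. c k + d k) * P"
    unfolding P_def by (simp add: F_deriv algebra_simps)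
  have "fact N * fps_nth P N = cumulant_moment (\<lambda>k. c k + d k) N"
  proof (rule cumulant_moment_unique)
    show "fact 0 * fps_nth P 0 = 1" by (simp add: P_def F_def)
    fix N
    have "fact (Suc N) * fps_nth P (Suc N) = fact N * fps_nth (fps_deriv P) N"
      by (simp add: fps_deriv_nth)
    also have "\<dots> = (\<Sum>k\<le>N. fact N * ((c (Suc k) + d (Suc k)) / fact k * fps_nth P (N - k)))"
      unfolding P_deriv fps_mult_nth K_nth atLeast0AtMost sum_distrib_left ..
    also have "\<dots> = (\<Sum>k\<le>N. real (N choose k) * (c (Suc k) + d (Suc k)) * (fact (N - k) * fps_nth P (N - k)))"
      by (intro sum.cong refl) (simp add: binom)
    finally show "fact (Suc N) * fps_nth P (Suc N) = \<dots>" .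
  qed
  moreover have "fact N * fps_nth P N =
      (\<Sum>l\<le>N. real (N choose l) * cumulant_moment c l * cumulant_moment d (N - l))"
    unfolding P_def fps_mult_nth F_nth atLeast0AtMost sum_distrib_left
    by (intro sum.cong refl) (simp add: binom)
  moreover have "\<dots> = (\<Sum>l\<le>N. real (N choose l) * cumulant_moment c (N - l) * cumulant_moment d l)"
    by (rule sum.reindex_bij_witness[of _ "\<lambda>l. N - l" "\<lambda>l. N - l"]) (auto simp flip: binomial_symmetric)
  ultimately show ?thesis by simp
qed

section \<open>Poisson moments, Stirling numbers and Bell numbers\<close>

text \<open>
  Factorial moments of a Poisson law, without the normalisation \<open>exp (- a)\<close>: the first \<open>r\<close> terms vanish,
  and cancelling the falling factorial against \<open>fact n\<close> leaves a shifted exponential series.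
\<close>
lemma falling_factorial_poisson_sums:
  "(\<lambda>n. (\<Prod>j<r. real n - real j) * (a ^ n / fact n)) sums (a ^ r * exp a)" for a :: real
proof -
  have shift: "(\<Prod>j<r. real (n + r) - real j) * (a ^ (n + r) / fact (n + r)) = a ^ r * (a ^ n / fact n)" for n
  proof -
    have "fact (n + r) = (\<Prod>j<r. real (n + r) - real j) * fact n"
    proof (induction r arbitrary: n)
      case (Suc r)
      have "fact (n + Suc r) = (\<Prod>j<r. real (Suc n + r) - real j) * fact (Suc n)"
        using Suc[of "Suc n"] by simp
      then show ?case by (simp add: algebra_simps)
    qed simp
    moreover have "fact (n + r) \<noteq> (0::real)" by simp
    ultimately show ?thesis by (auto simp: power_add)
  qed
  have zero: "(\<Prod>j<r. real n - real j) = 0" if "n < r" for n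
    using that by (intro prod_zero) auto
  have "(\<lambda>n. a ^ r * (a ^ n / fact n)) sums (a ^ r * exp a)"
    using exp_converges[of a] by (intro sums_mult) (simp add: divide_inverse mult_ac)
  then have "(\<lambda>n. (\<Prod>j<r. real (n + r) - real j) * (a ^ (n + r) / fact (n + r))) sums (a ^ r * exp a)"
    unfolding shift .
  then show ?thesis
    by (subst (asm) sums_iff_shift) (simp add: zero)
qed

lemma poisson_moment_sums_Stirling:
  "(\<lambda>n. real n ^ N * (a ^ n / fact n)) sums (exp a * (\<Sum>r\<le>N. real (Stirling N r) * a ^ r))" for a :: real
proof -
  have "(\<lambda>n. \<Sum>r\<le>N. real (Stirling N r) * ((\<Prod>j<r. real n - real j) * (a ^ n / fact n)))
      sums (\<Sum>r\<le>N. real (Stirling N r) * (a ^ r * exp a))"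
    by (intro sums_sum sums_mult falling_factorial_poisson_sums)
  then show ?thesis
    by (subst power_eq_sum_Stirling) (simp add: sum_distrib_left sum_distrib_right mult_ac)
qed

text \<open>
  All cumulants of a Poisson law equal its parameter. For the moments \<open>T N\<close> this amounts to
  \<open>E \<theta> ^ (N + 1) = a * E (\<theta> + 1) ^ N\<close>, an index shift in the series.
\<close>
lemma Touchard_eq_cumulant_moment:
  "(\<Sum>r\<le>N. real (Stirling N r) * a ^ r) = cumulant_moment (\<lambda>_. a) N"
proof (rule cumulant_moment_unique)
  show "(\<Sum>r\<le>0. real (Stirling 0 r) * a ^ r) = 1" by simp
  fix N
  let ?T = "\<lambda>N. \<Sum>r\<le>N. real (Stirling N r) * a ^ r"
  have "(\<lambda>n. real (Suc n) ^ Suc N * (a ^ Suc n / fact (Suc n))) sums (exp a * ?T (Suc N))"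
    using poisson_moment_sums_Stirling[of "Suc N" a] by (subst sums_Suc_iff) simp
  moreover have "real (Suc n) ^ Suc N * (a ^ Suc n / fact (Suc n)) =
      (\<Sum>k\<le>N. real (N choose k) * a * (real n ^ (N - k) * (a ^ n / fact n)))" for n
  proof -
    have "real (Suc n) ^ Suc N * (a ^ Suc n / fact (Suc n)) = (1 + real n) ^ N * (a * (a ^ n / fact n))"
      by (simp add: field_simps del: of_nat_Suc) (simp add: algebra_simps)
    also have "(1 + real n) ^ N = (\<Sum>k\<le>N. real (N choose k) * real n ^ (N - k))"
      by (subst binomial_ring) simp
    finally show ?thesis by (simp add: sum_distrib_left sum_distrib_right mult_ac)
  qed
  ultimately have "(\<lambda>n. \<Sum>k\<le>N. real (N choose k) * a * (real n ^ (N - k) * (a ^ n / fact n)))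
      sums (exp a * ?T (Suc N))" by simp
  moreover have "(\<lambda>n. \<Sum>k\<le>N. real (N choose k) * a * (real n ^ (N - k) * (a ^ n / fact n)))
      sums (\<Sum>k\<le>N. real (N choose k) * a * (exp a * ?T (N - k)))"
    by (intro sums_sum sums_mult poisson_moment_sums_Stirling)
  ultimately have "exp a * ?T (Suc N) = (\<Sum>k\<le>N. real (N choose k) * a * (exp a * ?T (N - k)))"
    by (rule sums_unique2)
  also have "\<dots> = exp a * (\<Sum>k\<le>N. real (N choose k) * a * ?T (N - k))"
    by (simp add: sum_distrib_left mult_ac)
  finally show "?T (Suc N) = (\<Sum>k\<le>N. real (N choose k) * a * ?T (N - k))" by simp
qed

text \<open>
  The first cumulant of a constant is its value, and the others vanish.
\<close>
lemma cumulant_moment_Dirac: "cumulant_moment (\<lambda>k. if k = 1 then a else 0) N = a ^ N"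
proof (rule cumulant_moment_unique[symmetric])
  fix N
  have "(\<Sum>k\<le>N. real (N choose k) * (if Suc k = 1 then a else 0) * a ^ (N - k)) =
      (\<Sum>k\<in>{0}. real (N choose k) * (if Suc k = 1 then a else 0) * a ^ (N - k))"
    by (intro sum.mono_neutral_right) auto
  then show "a ^ Suc N = (\<Sum>k\<le>N. real (N choose k) * (if Suc k = 1 then a else 0) * a ^ (N - k))"
    by simp
qed simp

text \<open>
  The binomial convolution describes \<open>\<theta> - 1\<close> as the independent sum of a Poisson variable of
  parameter \<open>1\<close> and the constant \<open>-1\<close>, which removes the first cumulant.
\<close>
lemma centered_poisson_closed_form:
  "(\<Sum>l\<le>N. (-1) ^ l * real (N choose l) * (\<Sum>r\<le>N-l. real (Stirling (N - l) r))) =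
     cumulant_moment (\<lambda>k. of_bool (k \<noteq> 1)) N"
proof -
  have "(\<Sum>r\<le>j. real (Stirling j r)) = cumulant_moment (\<lambda>_. 1) j" for j
    using Touchard_eq_cumulant_moment[of j 1] by simp
  then have "(\<Sum>l\<le>N. (-1) ^ l * real (N choose l) * (\<Sum>r\<le>N-l. real (Stirling (N - l) r))) =
      (\<Sum>l\<le>N. real (N choose l) * cumulant_moment (\<lambda>_. 1) (N - l) *
         cumulant_moment (\<lambda>k. if k = 1 then -1 else 0) l)"
    by (simp add: cumulant_moment_Dirac[of "-1"] mult_ac del: One_nat_def)
  also have "\<dots> = cumulant_moment (\<lambda>k. 1 + (if k = 1 then -1 else 0)) N"
    by (rule cumulant_moment_add)
  also have "(\<lambda>k. 1 + (if k = 1 then -1 else 0)) = (\<lambda>k::nat. of_bool (k \<noteq> 1) :: real)"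
    by auto
  finally show ?thesis .
qed

text \<open>
  The binomial convolution describes \<open>\<theta>1 - \<theta>2\<close> for independent Poisson variables of parameter \<open>1/2\<close>;
  its \<open>k\<close>-th cumulant is \<open>1/2 + (-1) ^ k / 2\<close>.
\<close>
lemma symmetrized_poisson_closed_form:
  "(\<Sum>l\<le>N. (-1) ^ l * real (N choose l) *
      (\<Sum>q\<le>N-l. \<Sum>r\<le>l. (1 / 2 ^ (r + q)) * real (Stirling (N - l) q) * real (Stirling l r))) =
     cumulant_moment (\<lambda>k. of_bool (even k)) N"
proof -
  let ?h = "cumulant_moment (\<lambda>_. 1 / 2)"
  have inner: "(\<Sum>q\<le>i. \<Sum>r\<le>j. (1 / 2 ^ (r + q)) * real (Stirling i q) * real (Stirling j r)) = ?h i * ?h j" for i j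
    unfolding Touchard_eq_cumulant_moment[symmetric] sum_product
    by (simp add: power_add power_one_over field_simps)
  have "cumulant_moment (\<lambda>k. (-1) ^ k * (1 / 2)) l = (-1) ^ l * ?h l" for l
    by (rule cumulant_moment_scale)
  then have "(\<Sum>l\<le>N. (-1) ^ l * real (N choose l) * (?h (N - l) * ?h l)) =
      (\<Sum>l\<le>N. real (N choose l) * ?h (N - l) * cumulant_moment (\<lambda>k. (-1) ^ k * (1 / 2)) l)"
    by (simp add: mult_ac)
  also have "\<dots> = cumulant_moment (\<lambda>k. 1 / 2 + (-1) ^ k * (1 / 2)) N"
    by (rule cumulant_moment_add)
  also have "(\<lambda>k. 1 / 2 + (-1) ^ k * (1 / 2)) = (\<lambda>k::nat. of_bool (even k) :: real)"
    by (auto simp: fun_eq_iff)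
  finally show ?thesis unfolding inner .
qed

lemma centered_poisson_moment_sums:
  "(\<lambda>n. exp (-1) * ((real n - 1) ^ N / fact n)) sums
     (\<Sum>l\<le>N. (-1) ^ l * real (N choose l) * (\<Sum>r\<le>N-l. real (Stirling (N - l) r)))"
proof -
  have "(\<lambda>n. real n ^ j * (1 ^ n / fact n)) sums (exp 1 * (\<Sum>r\<le>j. real (Stirling j r) * 1 ^ r))" for j
    by (rule poisson_moment_sums_Stirling)
  then have "(\<lambda>n. exp (-1) * (\<Sum>l\<le>N. (-1) ^ l * real (N choose l) * (real n ^ (N - l) * (1 ^ n / fact n)))) sums
     (exp (-1) * (\<Sum>l\<le>N. (-1) ^ l * real (N choose l) * (exp 1 * (\<Sum>r\<le>N-l. real (Stirling (N - l) r) * 1 ^ r))))"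
    by (intro sums_mult sums_sum)
  moreover have "(\<Sum>l\<le>N. (-1) ^ l * real (N choose l) * (real n ^ (N - l) * (1 ^ n / fact n))) =
      (real n - 1) ^ N / fact n" for n
    using binomial_ring[of "-1" "real n" N] by (simp add: sum_divide_distrib mult_ac)
  moreover have "exp (-1) * (\<Sum>l\<le>N. (-1) ^ l * real (N choose l) * (exp 1 * S l)) =
      (\<Sum>l\<le>N. (-1) ^ l * real (N choose l) * S l)" for S
  proof -
    have "(\<Sum>l\<le>N. (-1) ^ l * real (N choose l) * (exp 1 * S l)) =
        exp 1 * (\<Sum>l\<le>N. (-1) ^ l * real (N choose l) * S l)"
      by (simp add: sum_distrib_left mult_ac)
    then show ?thesis by (simp add: exp_minus)
  qed
  ultimately show ?thesis by simp
qed

text \<open>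
  Dobinski's formula: \<open>bell\<close> is defined by the series of Poisson moments with parameter \<open>1\<close>.
\<close>
lemma bell_eq_sum_Stirling: "bell N = (\<Sum>r\<le>N. real (Stirling N r))"
proof (cases "N = 0")
  case False
  then have "(\<lambda>n. real (Suc n) ^ N / fact (Suc n)) sums (exp 1 * (\<Sum>r\<le>N. real (Stirling N r)))"
    using poisson_moment_sums_Stirling[of N 1] by (subst sums_Suc_iff) (simp add: power_0_left)
  then have "bell N = exp (-1) * (exp 1 * (\<Sum>r\<le>N. real (Stirling N r)))"
    using False by (simp add: bell_def sums_unique[symmetric] del: fact_Suc of_nat_Suc)
  then show ?thesis by (simp add: mult.assoc[symmetric] mult_exp_exp)
qed (simp add: bell_def)

lemma powr_of_nat_even:
  assumes "even p" "p > 0"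
  shows "\<bar>x\<bar> powr real p = (x::real) ^ p"
  using assms by (cases "x = 0") (auto simp: powr_realpow power_even_abs)

lemma poisson_L_even:
  assumes "even p" "p > 0"
  shows "poisson_L (real p) = (\<Sum>l\<le>p. (-1) ^ l * real (p choose l) * (\<Sum>r\<le>p-l. real (Stirling (p - l) r)))"
  using sums_unique2[OF poisson_L_sums[of "real p"]] centered_poisson_moment_sums[of p]
    powr_of_nat_even[OF assms] by simp

text \<open>
  Removing the absolute value changes only the term \<open>n = 0\<close>, which is \<open>1 / e\<close> instead of \<open>- 1 / e\<close>.
\<close>
lemma poisson_L_odd:
  assumes "odd p"
  shows "poisson_L (real p) = 2 / exp 1 + (\<Sum>l\<le>p. (-1) ^ l * real (p choose l) * bell (p - l))"
proof -
  have "exp (-1) * (\<bar>real n - 1\<bar> powr real p / fact n) =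
      (if n = 0 then 2 / exp 1 else 0) + exp (-1) * ((real n - 1) ^ p / fact n)" for n
  proof (cases "n \<ge> 2")
    case True
    then have "\<bar>real n - 1\<bar> powr real p = (real n - 1) ^ p" by (simp add: powr_realpow)
    with True show ?thesis by simp
  next
    case False
    then have "n = 0 \<or> n = 1" by auto
    then show ?thesis using assms by (auto simp: exp_minus field_simps odd_pos)
  qed
  moreover have "(\<lambda>n. (if n = 0 then 2 / exp 1 else 0) + exp (-1) * ((real n - 1) ^ p / fact n)) sums
      (2 / exp 1 + (\<Sum>l\<le>p. (-1) ^ l * real (p choose l) * bell (p - l)))"
    unfolding bell_eq_sum_Stirling
    by (intro sums_add centered_poisson_moment_sums sums_single)
  ultimately show ?thesis
    using sums_unique2[OF poisson_L_sums[of "real p"]] by simp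
qed

section \<open>Moments of sums of independent random variables\<close>

context prob_space
begin

lemma indep_power_mult_sum_power:
  fixes X :: "'i \<Rightarrow> 'a \<Rightarrow> real"
  assumes "indep_vars (\<lambda>_. borel) X (insert i J)" "finite J" "i \<notin> J"
    and "integrable M (\<lambda>\<omega>. X i \<omega> ^ a)" "integrable M (\<lambda>\<omega>. (\<Sum>j\<in>J. X j \<omega>) ^ b)"
  shows "integrable M (\<lambda>\<omega>. X i \<omega> ^ a * (\<Sum>j\<in>J. X j \<omega>) ^ b)"
    and "expectation (\<lambda>\<omega>. X i \<omega> ^ a * (\<Sum>j\<in>J. X j \<omega>) ^ b) =
      expectation (\<lambda>\<omega>. X i \<omega> ^ a) * expectation (\<lambda>\<omega>. (\<Sum>j\<in>J. X j \<omega>) ^ b)"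
proof -
  have "indep_var borel ((\<lambda>x. x ^ a) \<circ> X i) borel ((\<lambda>x. x ^ b) \<circ> (\<lambda>\<omega>. \<Sum>j\<in>J. X j \<omega>))"
    by (intro indep_var_compose[OF indep_vars_sum[OF assms(2,3,1)]]) auto
  then have ind: "indep_var borel (\<lambda>\<omega>. X i \<omega> ^ a) borel (\<lambda>\<omega>. (\<Sum>j\<in>J. X j \<omega>) ^ b)"
    by (simp add: o_def)
  show "integrable M (\<lambda>\<omega>. X i \<omega> ^ a * (\<Sum>j\<in>J. X j \<omega>) ^ b)"
    by (rule indep_var_integrable[OF ind assms(4,5)])
  show "expectation (\<lambda>\<omega>. X i \<omega> ^ a * (\<Sum>j\<in>J. X j \<omega>) ^ b) =
      expectation (\<lambda>\<omega>. X i \<omega> ^ a) * expectation (\<lambda>\<omega>. (\<Sum>j\<in>J. X j \<omega>) ^ b)"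
    by (rule indep_var_lebesgue_integral[OF ind assms(4,5)])
qed

lemma integrable_sum_power:
  fixes X :: "'i \<Rightarrow> 'a \<Rightarrow> real"
  assumes "finite I" "indep_vars (\<lambda>_. borel) X I"
    and "\<And>i k. i \<in> I \<Longrightarrow> k \<le> P \<Longrightarrow> integrable M (\<lambda>\<omega>. X i \<omega> ^ k)" "N \<le> P"
  shows "integrable M (\<lambda>\<omega>. (\<Sum>i\<in>I. X i \<omega>) ^ N)"
  using assms
proof (induction I arbitrary: N rule: finite_induct)
  case empty
  then show ?case by simp
next
  case (insert i J)
  have "indep_vars (\<lambda>_. borel) X J"
    using insert.prems(1) by (rule indep_vars_subset) auto
  then have "integrable M (\<lambda>\<omega>. (\<Sum>j\<in>J. X j \<omega>) ^ (N - k))" for k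
    using insert.prems by (intro insert.IH) auto
  then have "integrable M (\<lambda>\<omega>. X i \<omega> ^ k * (\<Sum>j\<in>J. X j \<omega>) ^ (N - k))" if "k \<le> N" for k
    using that insert.prems insert.hyps by (intro indep_power_mult_sum_power) auto
  then have "integrable M (\<lambda>\<omega>. \<Sum>k\<le>N. real (N choose k) * (X i \<omega> ^ k * (\<Sum>j\<in>J. X j \<omega>) ^ (N - k)))"
    by (intro Bochner_Integration.integrable_sum integrable_mult_right) auto
  then show ?case
    using insert.hyps by (simp add: binomial_ring mult.assoc)
qed

text \<open>
  The recursion behind both bounds: one factor of the power is \<open>\<Sum>i. X i\<close>, and the others are expanded
  by the binomial theorem around the sum over the remaining indices, which is independent of \<open>X i\<close>.
\<close>
lemma expectation_sum_power_Suc: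
  fixes X :: "'i \<Rightarrow> 'a \<Rightarrow> real"
  assumes I: "finite I" "indep_vars (\<lambda>_. borel) X I"
    and int: "\<And>i k. i \<in> I \<Longrightarrow> k \<le> P \<Longrightarrow> integrable M (\<lambda>\<omega>. X i \<omega> ^ k)" and "Suc N \<le> P"
  shows "expectation (\<lambda>\<omega>. (\<Sum>i\<in>I. X i \<omega>) ^ Suc N) =
    (\<Sum>i\<in>I. \<Sum>k\<le>N. real (N choose k) * expectation (\<lambda>\<omega>. X i \<omega> ^ Suc k) *
       expectation (\<lambda>\<omega>. (\<Sum>j\<in>I-{i}. X j \<omega>) ^ (N - k)))"
proof -
  have ind: "indep_vars (\<lambda>_. borel) X (insert i (I - {i}))" "indep_vars (\<lambda>_. borel) X (I - {i})" if "i \<in> I" for i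
    using that I(2) by (auto simp: insert_absorb intro: indep_vars_subset)
  have int_parts: "integrable M (\<lambda>\<omega>. X i \<omega> ^ Suc k)"
      "integrable M (\<lambda>\<omega>. (\<Sum>j\<in>I-{i}. X j \<omega>) ^ (N - k))" if "i \<in> I" "k \<le> N" for i k
  proof -
    show "integrable M (\<lambda>\<omega>. X i \<omega> ^ Suc k)"
      using that \<open>Suc N \<le> P\<close> by (intro int) auto
    show "integrable M (\<lambda>\<omega>. (\<Sum>j\<in>I-{i}. X j \<omega>) ^ (N - k))"
      using that \<open>Suc N \<le> P\<close> I(1) by (intro integrable_sum_power[OF _ ind(2) int]) auto
  qed
  have prod_int: "integrable M (\<lambda>\<omega>. X i \<omega> ^ Suc k * (\<Sum>j\<in>I-{i}. X j \<omega>) ^ (N - k))"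
    and prod_eq: "expectation (\<lambda>\<omega>. X i \<omega> ^ Suc k * (\<Sum>j\<in>I-{i}. X j \<omega>) ^ (N - k)) =
      expectation (\<lambda>\<omega>. X i \<omega> ^ Suc k) * expectation (\<lambda>\<omega>. (\<Sum>j\<in>I-{i}. X j \<omega>) ^ (N - k))"
    if "i \<in> I" "k \<le> N" for i k
    using indep_power_mult_sum_power[OF ind(1)[OF that(1)] _ _ int_parts[OF that]] I(1) by simp_all
  have "(\<Sum>i\<in>I. X i \<omega>) ^ Suc N =
      (\<Sum>i\<in>I. \<Sum>k\<le>N. real (N choose k) * (X i \<omega> ^ Suc k * (\<Sum>j\<in>I-{i}. X j \<omega>) ^ (N - k)))" for \<omega>
  proof -
    have "(\<Sum>i\<in>I. X i \<omega>) ^ Suc N = (\<Sum>i\<in>I. X i \<omega> * (\<Sum>j\<in>I. X j \<omega>) ^ N)"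
      by (simp add: sum_distrib_right)
    also have "\<dots> = (\<Sum>i\<in>I. X i \<omega> * (X i \<omega> + (\<Sum>j\<in>I-{i}. X j \<omega>)) ^ N)"
      using I(1) by (intro sum.cong refl) (simp add: sum.remove)
    finally show ?thesis
      by (simp add: binomial_ring sum_distrib_left mult_ac)
  qed
  then have "expectation (\<lambda>\<omega>. (\<Sum>i\<in>I. X i \<omega>) ^ Suc N) =
      expectation (\<lambda>\<omega>. \<Sum>i\<in>I. \<Sum>k\<le>N. real (N choose k) * (X i \<omega> ^ Suc k * (\<Sum>j\<in>I-{i}. X j \<omega>) ^ (N - k)))"
    by presburger
  also have "\<dots> = (\<Sum>i\<in>I. \<Sum>k\<le>N. real (N choose k) *
      expectation (\<lambda>\<omega>. X i \<omega> ^ Suc k * (\<Sum>j\<in>I-{i}. X j \<omega>) ^ (N - k)))"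
  proof -
    have inner: "integrable M (\<lambda>\<omega>. real (N choose k) * (X i \<omega> ^ Suc k * (\<Sum>j\<in>I-{i}. X j \<omega>) ^ (N - k)))"
      if "i \<in> I" "k \<le> N" for i k
      using prod_int[OF that] by (rule integrable_mult_right)
    have "expectation (\<lambda>\<omega>. \<Sum>k\<le>N. real (N choose k) * (X i \<omega> ^ Suc k * (\<Sum>j\<in>I-{i}. X j \<omega>) ^ (N - k))) =
        (\<Sum>k\<le>N. real (N choose k) * expectation (\<lambda>\<omega>. X i \<omega> ^ Suc k * (\<Sum>j\<in>I-{i}. X j \<omega>) ^ (N - k)))"
      if "i \<in> I" for i
      using inner[OF that] by (subst Bochner_Integration.integral_sum) auto
    then show ?thesis
      using inner
      by (subst Bochner_Integration.integral_sum) (auto intro!: Bochner_Integration.integrable_sum simp del: power_Suc)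
  qed
  also have "\<dots> = (\<Sum>i\<in>I. \<Sum>k\<le>N. real (N choose k) * expectation (\<lambda>\<omega>. X i \<omega> ^ Suc k) *
       expectation (\<lambda>\<omega>. (\<Sum>j\<in>I-{i}. X j \<omega>) ^ (N - k)))"
    by (intro sum.cong refl) (simp add: prod_eq mult.assoc del: power_Suc)
  finally show ?thesis .
qed

text \<open>
  The bound is proved for all subsets of \<open>I\<close> at once, because the recursion drops a summand. This
  costs nothing, as the hypothesis on \<open>c\<close> passes to subsets.
\<close>
lemma abs_expectation_sum_power_le:
  fixes X :: "'i \<Rightarrow> 'a \<Rightarrow> real"
  assumes "finite I" "indep_vars (\<lambda>_. borel) X I"
    and int: "\<And>i k. i \<in> I \<Longrightarrow> k \<le> P \<Longrightarrow> integrable M (\<lambda>\<omega>. X i \<omega> ^ k)"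
    and c: "\<And>k. 1 \<le> k \<Longrightarrow> k \<le> P \<Longrightarrow> (\<Sum>i\<in>I. \<bar>expectation (\<lambda>\<omega>. X i \<omega> ^ k)\<bar>) \<le> c k"
    and c_nonneg: "\<And>k. 1 \<le> k \<Longrightarrow> 0 \<le> c k"
    and "N \<le> P"
  shows "\<bar>expectation (\<lambda>\<omega>. (\<Sum>i\<in>I. X i \<omega>) ^ N)\<bar> \<le> cumulant_moment c N"
proof -
  have "\<bar>expectation (\<lambda>\<omega>. (\<Sum>i\<in>J. X i \<omega>) ^ N)\<bar> \<le> cumulant_moment c N" if "J \<subseteq> I" for J
    using \<open>N \<le> P\<close> that
  proof (induction N arbitrary: J rule: less_induct)
    case (less N)
    have J: "finite J" "indep_vars (\<lambda>_. borel) X J"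
      using finite_subset[OF less.prems(2) assms(1)] indep_vars_subset[OF assms(2) less.prems(2)] by auto
    show ?case
    proof (cases N)
      case 0
      then show ?thesis by (simp add: prob_space)
    next
      case (Suc n)
      define E where "E i k = expectation (\<lambda>\<omega>. X i \<omega> ^ k)" for i k
      define R where "R i k = expectation (\<lambda>\<omega>. (\<Sum>j\<in>J-{i}. X j \<omega>) ^ k)" for i k
      have R_le: "\<bar>R i (n - k)\<bar> \<le> cumulant_moment c (n - k)" if "i \<in> J" "k \<le> n" for i k
        unfolding R_def using that less.prems Suc by (intro less.IH) auto
      have expand: "expectation (\<lambda>\<omega>. (\<Sum>i\<in>J. X i \<omega>) ^ N) =
          (\<Sum>i\<in>J. \<Sum>k\<le>n. real (n choose k) * E i (Suc k) * R i (n - k))"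
        unfolding Suc E_def R_def
      proof (rule expectation_sum_power_Suc[OF J])
        show "integrable M (\<lambda>\<omega>. X i \<omega> ^ k)" if "i \<in> J" "k \<le> N" for i k
          using that less.prems by (intro int) auto
        show "Suc n \<le> N" using Suc by simp
      qed
      have "\<bar>expectation (\<lambda>\<omega>. (\<Sum>i\<in>J. X i \<omega>) ^ N)\<bar> \<le>
          (\<Sum>i\<in>J. \<Sum>k\<le>n. \<bar>real (n choose k) * E i (Suc k) * R i (n - k)\<bar>)"
        unfolding expand by (rule order_trans[OF sum_abs sum_mono[OF sum_abs]])
      also have "\<dots> \<le> (\<Sum>i\<in>J. \<Sum>k\<le>n. real (n choose k) * \<bar>E i (Suc k)\<bar> * cumulant_moment c (n - k))"
        unfolding abs_mult abs_of_nat using R_le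
        by (intro sum_mono mult_left_mono) auto
      also have "\<dots> = (\<Sum>k\<le>n. real (n choose k) * (\<Sum>i\<in>J. \<bar>E i (Suc k)\<bar>) * cumulant_moment c (n - k))"
        unfolding sum_distrib_left sum_distrib_right by (rule sum.swap)
      also have "\<dots> \<le> (\<Sum>k\<le>n. real (n choose k) * c (Suc k) * cumulant_moment c (n - k))"
      proof (intro sum_mono mult_right_mono mult_left_mono)
        fix k assume "k \<in> {..n}"
        then have "(\<Sum>i\<in>I. \<bar>E i (Suc k)\<bar>) \<le> c (Suc k)"
          unfolding E_def using less.prems Suc by (intro c) auto
        moreover have "(\<Sum>i\<in>J. \<bar>E i (Suc k)\<bar>) \<le> (\<Sum>i\<in>I. \<bar>E i (Suc k)\<bar>)"
          using assms(1) less.prems by (intro sum_mono2) auto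
        ultimately show "(\<Sum>i\<in>J. \<bar>E i (Suc k)\<bar>) \<le> c (Suc k)" by linarith
      qed (auto intro: cumulant_moment_nonneg c_nonneg)
      finally show ?thesis by (simp only: Suc cumulant_moment.simps)
    qed
  qed
  then show ?thesis by blast
qed

end

section \<open>Poisson limit of moments of i.i.d. sums\<close>

text \<open>
  The moments of a sum of \<open>n\<close> i.i.d. variables depend only on \<open>n\<close> and the moments \<open>e\<close> of one of them.
  Written as a function of these data, they can be studied in the limit with no reference to the
  varying probability spaces.
\<close>
fun iid_sum_moment :: "(nat \<Rightarrow> real) \<Rightarrow> nat \<Rightarrow> nat \<Rightarrow> real" where
  "iid_sum_moment e n 0 = 1"
| "iid_sum_moment e n (Suc N) =
     (\<Sum>k\<le>N. real (N choose k) * (real n * e (Suc k)) * iid_sum_moment e (n - 1) (N - k))"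

lemma (in prob_space) expectation_iid_sum_power:
  fixes X :: "'i \<Rightarrow> 'a \<Rightarrow> real"
  assumes "finite I" "indep_vars (\<lambda>_. borel) X I"
    and int: "\<And>i k. i \<in> I \<Longrightarrow> integrable M (\<lambda>\<omega>. X i \<omega> ^ k)"
    and e: "\<And>i k. i \<in> I \<Longrightarrow> expectation (\<lambda>\<omega>. X i \<omega> ^ k) = e k"
  shows "expectation (\<lambda>\<omega>. (\<Sum>i\<in>I. X i \<omega>) ^ N) = iid_sum_moment e (card I) N"
  using assms
proof (induction N arbitrary: I rule: less_induct)
  case (less N)
  show ?case
  proof (cases N)
    case 0
    then show ?thesis by (simp add: prob_space)
  next
    case (Suc n)
    have IH: "expectation (\<lambda>\<omega>. (\<Sum>j\<in>I-{i}. X j \<omega>) ^ (n - k)) = iid_sum_moment e (card I - 1) (n - k)"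
      if "i \<in> I" for i k
      using that less.prems indep_vars_subset[OF less.prems(2), of "I - {i}"] Suc
      by (subst less.IH) (auto simp: card_Diff_singleton)
    have "expectation (\<lambda>\<omega>. (\<Sum>i\<in>I. X i \<omega>) ^ N) =
        (\<Sum>i\<in>I. \<Sum>k\<le>n. real (n choose k) * e (Suc k) * iid_sum_moment e (card I - 1) (n - k))"
      unfolding Suc
      by (subst expectation_sum_power_Suc[of I X N])
         (use less.prems Suc in \<open>auto simp: IH simp del: power_Suc intro!: sum.cong\<close>)
    also have "\<dots> = iid_sum_moment e (card I) (Suc n)"
      by (simp add: sum_distrib_left mult_ac)
    finally show ?thesis by (simp only: Suc)
  qed
qed

text \<open>
  Convergence of moments in the law of rare events. The offset \<open>a\<close> is needed for the induction, since the recursion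
  passes from \<open>n\<close> to \<open>n - 1\<close> summands while the law of the summands stays that of index \<open>n\<close>.
\<close>
lemma iid_sum_moment_tendsto:
  assumes "\<And>k. 1 \<le> k \<Longrightarrow> (\<lambda>n. real n * e n k) \<longlonglongrightarrow> c k"
  shows "(\<lambda>n. iid_sum_moment (e n) (n - a) N) \<longlonglongrightarrow> cumulant_moment c N"
proof (induction N arbitrary: a rule: less_induct)
  case (less N)
  show ?case
  proof (cases N)
    case (Suc m)
    have "(\<lambda>n. real (n - a) * e n (Suc k)) \<longlonglongrightarrow> c (Suc k)" for k
    proof -
      have "\<forall>\<^sub>F n in sequentially. (real n - real a) / real n = real (n - a) / real n"
        using eventually_ge_at_top[of a] by eventually_elim (simp add: of_nat_diff)
      moreover have "(\<lambda>n. (real n - real a) / real n) \<longlonglongrightarrow> 1" by real_asymp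
      ultimately have "(\<lambda>n. real (n - a) / real n) \<longlonglongrightarrow> 1"
        by (rule Lim_transform_eventually[rotated])
      then have "(\<lambda>n. real (n - a) / real n * (real n * e n (Suc k))) \<longlonglongrightarrow> 1 * c (Suc k)"
        by (intro tendsto_mult assms) auto
      moreover have "\<forall>\<^sub>F n in sequentially.
          real (n - a) / real n * (real n * e n (Suc k)) = real (n - a) * e n (Suc k)"
        using eventually_gt_at_top[of 0] by eventually_elim simp
      ultimately show ?thesis by (auto intro: Lim_transform_eventually)
    qed
    then have "(\<lambda>n. \<Sum>k\<le>m. real (m choose k) * (real (n - a) * e n (Suc k)) *
          iid_sum_moment (e n) (n - Suc a) (m - k)) \<longlonglongrightarrow> cumulant_moment c N"
      unfolding Suc cumulant_moment.simps
      by (intro tendsto_sum tendsto_mult tendsto_const less.IH) (auto simp: Suc)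
    then show ?thesis by (simp add: Suc)
  qed simp
qed

section \<open>The upper bound for the ratio\<close>

text \<open>
  Convexity of \<open>t \<mapsto> y ^ t\<close> at \<open>k\<close> between \<open>2\<close> and \<open>p\<close>. As the weights add up to \<open>1\<close>, bounds by \<open>1\<close>
  on the second and \<open>p\<close>-th absolute moments carry over to the \<open>k\<close>-th.
\<close>
lemma power_le_interpolation:
  fixes y :: real
  assumes "0 \<le> y" "2 \<le> k" "k \<le> p" "2 < p"
  shows "y ^ k \<le> real (p - k) / real (p - 2) * y ^ 2 + real (k - 2) / real (p - 2) * y ^ p"
proof -
  define s where "s = real (k - 2) / real (p - 2)"
  have s: "0 \<le> s" "s \<le> 1" and s': "real (p - k) / real (p - 2) = 1 - s"
    using assms by (auto simp: s_def field_simps of_nat_diff)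
  show ?thesis
  proof (cases "y = 0")
    case True
    with assms show ?thesis by (simp add: power_0_left)
  next
    case False
    then have y: "y > 0" using assms by simp
    \<comment> \<open>\<open>y ^ t\<close> is \<open>exp (t * ln y)\<close>, which reduces the claim to convexity of \<open>exp\<close>.\<close>
    have "exp ((1 - s) * (2 * ln y) + s * (real p * ln y)) \<le> (1 - s) * exp (2 * ln y) + s * exp (real p * ln y)"
      using convex_onD[OF exp_convex, of s "2 * ln y" "real p * ln y"] s by simp
    moreover have "(1 - s) * (2 * ln y) + s * (real p * ln y) = real k * ln y"
    proof -
      have "(1 - s) * 2 + s * real p = real k"
      proof -
        have "s * real (p - 2) = real (k - 2)" using assms by (simp add: s_def)
        then show ?thesis using assms by (simp add: of_nat_diff algebra_simps)
      qed
      then show ?thesis by (metis distrib_right mult.assoc)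
    qed
    moreover have "exp (real j * ln y) = y ^ j" for j
      using y by (simp add: exp_of_nat_mult)
    from this[of 2] this[of p] this[of k] have "exp (2 * ln y) = y ^ 2" "exp (real p * ln y) = y ^ p" "exp (real k * ln y) = y ^ k"
      by simp_all
    ultimately show ?thesis unfolding s' s_def[symmetric] by simp
  qed
qed

lemma integrable_power_of_integrable_powr:
  fixes X :: "'a \<Rightarrow> real"
  assumes "prob_space M" "X \<in> borel_measurable M" "integrable M (\<lambda>\<omega>. \<bar>X \<omega>\<bar> powr real p)" "k \<le> p" "p > 0"
  shows "integrable M (\<lambda>\<omega>. \<bar>X \<omega>\<bar> ^ k)" "integrable M (\<lambda>\<omega>. X \<omega> ^ k)"
proof -
  interpret prob_space M by fact
  have "\<bar>x\<bar> ^ k \<le> 1 + \<bar>x\<bar> powr real p" for x :: real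
  proof (cases "\<bar>x\<bar> \<le> 1")
    case True
    then have "\<bar>x\<bar> ^ k \<le> 1" by (intro power_le_one) auto
    then show ?thesis by (simp add: add_increasing2)
  next
    case False
    then have "\<bar>x\<bar> ^ k \<le> \<bar>x\<bar> ^ p" using assms(4) by (intro power_increasing) auto
    moreover have "\<bar>x\<bar> powr real p = \<bar>x\<bar> ^ p" using False by (intro powr_realpow) auto
    ultimately show ?thesis by linarith
  qed
  then have bound: "AE \<omega> in M. norm (\<bar>X \<omega>\<bar> ^ k) \<le> norm (1 + \<bar>X \<omega>\<bar> powr real p)"
    "AE \<omega> in M. norm (X \<omega> ^ k) \<le> norm (1 + \<bar>X \<omega>\<bar> powr real p)"
    by (auto simp: power_abs intro!: AE_I2)
  have "integrable M (\<lambda>\<omega>. 1 + \<bar>X \<omega>\<bar> powr real p)"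
    using assms(3) by simp
  then show "integrable M (\<lambda>\<omega>. \<bar>X \<omega>\<bar> ^ k)" "integrable M (\<lambda>\<omega>. X \<omega> ^ k)"
    using assms(2) by (intro Bochner_Integration.integrable_bound[OF _ _ bound(1)] Bochner_Integration.integrable_bound[OF _ _ bound(2)]; measurable)+
qed

lemma (in prob_space) expectation_square_sum_centered:
  fixes X :: "'i \<Rightarrow> 'a \<Rightarrow> real"
  assumes "finite I" "indep_vars (\<lambda>_. borel) X I"
    and int: "\<And>i k. i \<in> I \<Longrightarrow> k \<le> 2 \<Longrightarrow> integrable M (\<lambda>\<omega>. X i \<omega> ^ k)"
    and "\<And>i. i \<in> I \<Longrightarrow> expectation (X i) = 0"
  shows "expectation (\<lambda>\<omega>. (\<Sum>i\<in>I. X i \<omega>) ^ 2) = (\<Sum>i\<in>I. expectation (\<lambda>\<omega>. X i \<omega> ^ 2))"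
proof -
  have "expectation (\<lambda>\<omega>. (\<Sum>i\<in>I. X i \<omega>) ^ Suc 1) =
    (\<Sum>i\<in>I. \<Sum>k\<le>1. real (1 choose k) * expectation (\<lambda>\<omega>. X i \<omega> ^ Suc k) *
       expectation (\<lambda>\<omega>. (\<Sum>j\<in>I-{i}. X j \<omega>) ^ (1 - k)))"
    by (rule expectation_sum_power_Suc[OF assms(1,2) int]) auto
  also have "\<dots> = (\<Sum>i\<in>I. expectation (\<lambda>\<omega>. X i \<omega> ^ 2))"
    using assms(4) by (intro sum.cong refl) (simp add: prob_space numeral_2_eq_2)
  finally show ?thesis by (simp add: numeral_2_eq_2)
qed

text \<open>
  For even exponents the absolute values disappear, and for centered summands the variance is additive, so
  the ratio becomes an expression in moments only.
\<close>
lemma rosenthal_ratio_centered_even: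
  assumes seq: "indep_lp_seq M (real p) \<xi>" and p: "even p" "2 \<le> p"
    and centered: "\<And>i. (\<integral>\<omega>. \<xi> i \<omega> \<partial>M) = 0"
  shows "rosenthal_ratio M (real p) \<xi> n =
    (\<integral>\<omega>. (\<Sum>i<n. \<xi> i \<omega>) ^ p \<partial>M) powr (1 / real p) /
    max (sqrt (\<Sum>i<n. \<integral>\<omega>. \<xi> i \<omega> ^ 2 \<partial>M)) ((\<Sum>i<n. \<integral>\<omega>. \<xi> i \<omega> ^ p \<partial>M) powr (1 / real p))"
proof -
  interpret prob_space M using seq by (simp add: indep_lp_seq_def)
  have indep: "indep_vars (\<lambda>_. borel) \<xi> UNIV"
    using seq by (simp add: indep_lp_seq_def)
  have meas: "\<xi> i \<in> borel_measurable M" for i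
    using indep by (auto simp: indep_vars_def2)
  have int: "integrable M (\<lambda>\<omega>. \<xi> i \<omega> ^ k)" if "k \<le> p" for i k
    using seq that p meas[of i] prob_space_axioms
    by (intro integrable_power_of_integrable_powr(2)[of M "\<xi> i" p]) (auto simp: indep_lp_seq_def)
  have square: "(\<integral>\<omega>. (\<Sum>i<n. \<xi> i \<omega>) ^ 2 \<partial>M) = (\<Sum>i<n. \<integral>\<omega>. \<xi> i \<omega> ^ 2 \<partial>M)"
    using p by (intro expectation_square_sum_centered) (auto intro: indep_vars_subset[OF indep] int centered)
  have norm_p: "lp_norm M (real p) X = (\<integral>\<omega>. X \<omega> ^ p \<partial>M) powr (1 / real p)" for X
    unfolding lp_norm_def using powr_of_nat_even[of p] p by simp
  have norm_2: "lp_norm M 2 X = sqrt (\<integral>\<omega>. X \<omega> ^ 2 \<partial>M)" for X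
    unfolding lp_norm_def using powr_of_nat_even[of 2] by (simp add: powr_half_sqrt)
  have "lp_norm M (real p) (\<xi> i) powr real p = (\<integral>\<omega>. \<xi> i \<omega> ^ p \<partial>M)" for i
  proof -
    have "0 \<le> (\<integral>\<omega>. \<xi> i \<omega> ^ p \<partial>M)"
      using p by (intro integral_nonneg_AE) (simp add: zero_le_even_power)
    then show ?thesis
      unfolding norm_p using p by (simp add: powr_powr)
  qed
  then show ?thesis
    unfolding rosenthal_ratio_def norm_2 square by (simp add: norm_p)
qed

text \<open>
  The upper bound for centered (\<open>P k \<longleftrightarrow> k \<noteq> 1\<close>) and symmetric (\<open>P k \<longleftrightarrow> even k\<close>) sequences together:
  \<open>P\<close> marks the exponents whose moments may be nonzero. With \<open>D\<close> the denominator of the ratio,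
  interpolation bounds the sums of absolute moments by \<open>D ^ k\<close>, and the recursion then bounds the numerator.
\<close>
lemma rosenthal_ratio_le_cumulant_moment:
  fixes P :: "nat \<Rightarrow> bool"
  assumes seq: "indep_lp_seq M (real p) \<xi>" and p: "even p" "4 \<le> p"
    and vanish: "\<And>i k. 1 \<le> k \<Longrightarrow> k \<le> p \<Longrightarrow> \<not> P k \<Longrightarrow> (\<integral>\<omega>. \<xi> i \<omega> ^ k \<partial>M) = 0"
    and "\<not> P 1"
  shows "rosenthal_ratio M (real p) \<xi> n \<le> cumulant_moment (\<lambda>k. of_bool (P k)) p powr (1 / real p)"
proof -
  interpret prob_space M using seq by (simp add: indep_lp_seq_def)
  have indep: "indep_vars (\<lambda>_. borel) \<xi> UNIV"
    using seq by (simp add: indep_lp_seq_def)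
  have meas: "\<xi> i \<in> borel_measurable M" for i
    using indep by (auto simp: indep_vars_def2)
  have int: "integrable M (\<lambda>\<omega>. \<xi> i \<omega> ^ k)" "integrable M (\<lambda>\<omega>. \<bar>\<xi> i \<omega>\<bar> ^ k)" if "k \<le> p" for i k
    using seq that p meas[of i] prob_space_axioms
    by (intro integrable_power_of_integrable_powr[of M "\<xi> i" p]; simp add: indep_lp_seq_def)+
  define A where "A k = (\<Sum>i<n. \<integral>\<omega>. \<bar>\<xi> i \<omega>\<bar> ^ k \<partial>M)" for k
  define D where "D = max (sqrt (A 2)) (A p powr (1 / real p))"
  define \<mu> where "\<mu> = cumulant_moment (\<lambda>k. of_bool (P k)) p"
  have \<mu>: "\<mu> \<ge> 0" unfolding \<mu>_def by (intro cumulant_moment_nonneg) auto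
  have A_nonneg: "A k \<ge> 0" for k
    unfolding A_def by (intro sum_nonneg integral_nonneg_AE) auto
  have ratio: "rosenthal_ratio M (real p) \<xi> n = (\<integral>\<omega>. (\<Sum>i<n. \<xi> i \<omega>) ^ p \<partial>M) powr (1 / real p) / D"
    using rosenthal_ratio_centered_even[OF seq p(1)] p vanish[of 1] \<open>\<not> P 1\<close>
    by (simp add: D_def A_def power_even_abs)
  have "D \<ge> 0" unfolding D_def using A_nonneg by (simp add: le_max_iff_disj)
  then consider "D = 0" | "D > 0" by linarith
  then show ?thesis
  proof cases
    \<comment> \<open>The ratio is \<open>0\<close> then, by the convention \<open>x / 0 = 0\<close>.\<close>
    case 1
    then show ?thesis by (simp add: ratio)
  next
    case 2
    have A2: "A 2 \<le> D ^ 2"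
      using A_nonneg[of 2] \<open>D \<ge> 0\<close> by (simp add: D_def sqrt_le_D real_sqrt_le_iff le_max_iff_disj sqrt_le_D)
    have Ap: "A p \<le> D ^ p"
    proof -
      have "A p = (A p powr (1 / real p)) powr real p"
        using p A_nonneg[of p] by (simp add: powr_powr)
      also have "\<dots> \<le> D powr real p"
        by (intro powr_mono2) (auto simp: D_def)
      finally show ?thesis using 2 by (simp add: powr_realpow)
    qed
    have A_le: "A k \<le> D ^ k" if k: "2 \<le> k" "k \<le> p" for k
    proof -
      let ?a = "real (p - k) / real (p - 2)" and ?b = "real (k - 2) / real (p - 2)"
      have "\<bar>\<xi> i \<omega>\<bar> ^ k \<le> D ^ k * (?a * (\<bar>\<xi> i \<omega>\<bar> ^ 2 / D ^ 2) + ?b * (\<bar>\<xi> i \<omega>\<bar> ^ p / D ^ p))" for i \<omega>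
        using power_le_interpolation[of "\<bar>\<xi> i \<omega>\<bar> / D" k p] k p 2
        by (simp add: power_divide pos_divide_le_eq mult.commute del: power2_abs)
      then have "A k \<le> (\<Sum>i<n. \<integral>\<omega>. D ^ k * (?a * (\<bar>\<xi> i \<omega>\<bar> ^ 2 / D ^ 2) + ?b * (\<bar>\<xi> i \<omega>\<bar> ^ p / D ^ p)) \<partial>M)"
        unfolding A_def using k p
        by (intro sum_mono integral_mono int integrable_mult_right Bochner_Integration.integrable_add integrable_divide) auto
      also have "\<dots> = D ^ k * (?a * (A 2 / D ^ 2) + ?b * (A p / D ^ p))"
      proof -
        have "(\<integral>\<omega>. D ^ k * (?a * (\<bar>\<xi> i \<omega>\<bar> ^ 2 / D ^ 2) + ?b * (\<bar>\<xi> i \<omega>\<bar> ^ p / D ^ p)) \<partial>M) =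
            D ^ k * (?a * ((\<integral>\<omega>. \<bar>\<xi> i \<omega>\<bar> ^ 2 \<partial>M) / D ^ 2) + ?b * ((\<integral>\<omega>. \<bar>\<xi> i \<omega>\<bar> ^ p \<partial>M) / D ^ p))" for i
          using int(2)[of 2 i] int(2)[of p i] p by (simp del: power2_abs)
        then show ?thesis
          unfolding A_def
          by (simp only: sum_distrib_left[symmetric] sum.distrib sum_divide_distrib[symmetric])
      qed
      also have "\<dots> \<le> D ^ k * (?a * 1 + ?b * 1)"
        using A2 Ap 2 by (intro mult_left_mono add_mono) auto
      also have "?a * 1 + ?b * 1 = 1"
        using k p by (simp add: add_divide_distrib[symmetric] of_nat_diff)
      finally show ?thesis by simp
    qed
    have "\<bar>\<integral>\<omega>. (\<Sum>i<n. \<xi> i \<omega>) ^ p \<partial>M\<bar> \<le> cumulant_moment (\<lambda>k. D ^ k * of_bool (P k)) p"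
    proof (rule abs_expectation_sum_power_le[where P = p])
      fix k :: nat assume k: "1 \<le> k" "k \<le> p"
      show "(\<Sum>i<n. \<bar>\<integral>\<omega>. \<xi> i \<omega> ^ k \<partial>M\<bar>) \<le> D ^ k * of_bool (P k)"
      proof (cases "P k")
        case True
        with \<open>\<not> P 1\<close> have "k \<noteq> 1" by metis
        have "(\<Sum>i<n. \<bar>\<integral>\<omega>. \<xi> i \<omega> ^ k \<partial>M\<bar>) \<le> A k"
          unfolding A_def power_abs[symmetric] by (intro sum_mono integral_abs_bound)
        also have "\<dots> \<le> D ^ k"
          using k \<open>k \<noteq> 1\<close> by (intro A_le) auto
        finally show ?thesis using True by simp
      qed (use k vanish in simp)
    qed (use 2 in \<open>auto intro: indep_vars_subset[OF indep] int\<close>)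
    also have "\<dots> = D ^ p * \<mu>"
      unfolding \<mu>_def by (rule cumulant_moment_scale)
    finally have "(\<integral>\<omega>. (\<Sum>i<n. \<xi> i \<omega>) ^ p \<partial>M) powr (1 / real p) \<le> (D ^ p * \<mu>) powr (1 / real p)"
      using p by (intro powr_mono2 integral_nonneg_AE) (auto simp: zero_le_even_power)
    also have "\<dots> = D * \<mu> powr (1 / real p)"
      using 2 \<mu> p by (simp add: powr_mult powr_realpow[symmetric] powr_powr)
    finally show ?thesis
      unfolding ratio \<mu>_def[symmetric] using 2 by (simp add: pos_divide_le_eq mult.commute)
  qed
qed

section \<open>Ratios of i.i.d. sequences\<close>

definition iid_space :: "real pmf \<Rightarrow> (nat \<Rightarrow> real) measure" where
  "iid_space q = PiM UNIV (\<lambda>_. distr (measure_pmf q) borel (\<lambda>x. x))"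

lemma prob_space_iid_space: "prob_space (iid_space q)"
  unfolding iid_space_def by (intro prob_space_PiM measure_pmf.prob_space_distr) simp

lemma sets_iid_space [measurable_cong]: "sets (iid_space q) = sets (PiM UNIV (\<lambda>_. borel))"
  unfolding iid_space_def by (intro sets_PiM_cong) auto

lemma measurable_component_iid_space [measurable]: "(\<lambda>\<omega>. \<omega> i) \<in> borel_measurable (iid_space q)"
  by (subst measurable_cong_sets[OF sets_iid_space refl]) (rule measurable_component_singleton, simp)

lemma distr_iid_space: "distr (iid_space q) borel (\<lambda>\<omega>. \<omega> i) = distr (measure_pmf q) borel (\<lambda>x. x)"
proof -
  let ?N = "distr (measure_pmf q) borel (\<lambda>x. x)"
  have "distr (iid_space q) borel (\<lambda>\<omega>. \<omega> i) = distr (iid_space q) ?N (\<lambda>\<omega>. \<omega> i)"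
    by (rule distr_cong) auto
  also have "\<dots> = ?N"
    unfolding iid_space_def by (rule distr_PiM_component) (auto intro!: measure_pmf.prob_space_distr)
  finally show ?thesis .
qed

lemma indep_vars_iid_space: "prob_space.indep_vars (iid_space q) (\<lambda>_. borel) (\<lambda>i \<omega>. \<omega> i) UNIV"
proof -
  interpret prob_space "iid_space q" by (rule prob_space_iid_space)
  have "distr (iid_space q) (PiM UNIV (\<lambda>_. borel)) (\<lambda>\<omega>. \<omega>) = iid_space q"
    by (rule distr_id2) (rule sets_iid_space[symmetric])
  then show ?thesis
    by (subst indep_vars_iff_distr_eq_PiM) (auto simp: distr_iid_space restrict_def iid_space_def[symmetric])
qed

lemma integral_iid_space:
  fixes f :: "real \<Rightarrow> real"
  assumes [measurable]: "f \<in> borel_measurable borel"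
  shows "(\<integral>\<omega>. f (\<omega> i) \<partial>iid_space q) = measure_pmf.expectation q f"
    and "integrable (iid_space q) (\<lambda>\<omega>. f (\<omega> i)) \<longleftrightarrow> integrable (measure_pmf q) f"
  using integral_distr[of "\<lambda>\<omega>. \<omega> i" "iid_space q" borel f] integral_distr[of "\<lambda>x. x" "measure_pmf q" borel f]
    integrable_distr_eq[of "\<lambda>\<omega>. \<omega> i" "iid_space q" borel f] integrable_distr_eq[of "\<lambda>x. x" "measure_pmf q" borel f]
  by (simp_all add: distr_iid_space)

lemma indep_lp_seq_iid_space:
  assumes "finite (set_pmf q)"
  shows "indep_lp_seq (iid_space q) p (\<lambda>i \<omega>. \<omega> i)"
  unfolding indep_lp_seq_def
  using prob_space_iid_space indep_vars_iid_space integral_iid_space(2)[of "\<lambda>x. \<bar>x\<bar> powr p" q]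
  by (auto intro: integrable_measure_pmf_finite assms)

text \<open>
  With \<open>P 2\<close> and \<open>P p\<close> both quantities in the denominator tend to \<open>1\<close>, so the limit is that of the numerator.
\<close>
lemma rosenthal_ratio_iid_tendsto:
  fixes q :: "nat \<Rightarrow> real pmf" and P :: "nat \<Rightarrow> bool"
  assumes p: "even p" "2 \<le> p"
    and fin: "\<And>n. finite (set_pmf (q n))"
    and centered: "\<And>n. measure_pmf.expectation (q n) (\<lambda>x. x) = 0"
    and lim: "\<And>k. 1 \<le> k \<Longrightarrow> (\<lambda>n. real n * measure_pmf.expectation (q n) (\<lambda>x. x ^ k)) \<longlonglongrightarrow> of_bool (P k)"
    and "P 2" "P p"
  shows "(\<lambda>n. rosenthal_ratio (iid_space (q n)) (real p) (\<lambda>i \<omega>. \<omega> i) n)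
    \<longlonglongrightarrow> cumulant_moment (\<lambda>k. of_bool (P k)) p powr (1 / real p)"
proof -
  define e where "e n k = measure_pmf.expectation (q n) (\<lambda>x. x ^ k)" for n k
  have moment: "(\<integral>\<omega>. \<omega> i ^ k \<partial>iid_space (q n)) = e n k" for i k n
    unfolding e_def by (rule integral_iid_space) simp
  have sum_moment: "(\<integral>\<omega>. (\<Sum>i<n. \<omega> i) ^ p \<partial>iid_space (q n)) = iid_sum_moment (e n) n p" for n
  proof -
    interpret prob_space "iid_space (q n)" by (rule prob_space_iid_space)
    have "integrable (iid_space (q n)) (\<lambda>\<omega>. \<omega> i ^ k)" for i k
      by (subst integral_iid_space(2)[of "\<lambda>x. x ^ k"]) (auto intro: integrable_measure_pmf_finite fin)
    then show ?thesis
      using expectation_iid_sum_power[of "{..<n}" "\<lambda>i \<omega>. \<omega> i" "e n" p]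
      by (auto simp: moment intro: indep_vars_subset[OF indep_vars_iid_space])
  qed
  have ratio: "rosenthal_ratio (iid_space (q n)) (real p) (\<lambda>i \<omega>. \<omega> i) n =
      iid_sum_moment (e n) n p powr (1 / real p) /
      max (sqrt (real n * e n 2)) ((real n * e n p) powr (1 / real p))" for n
    by (subst rosenthal_ratio_centered_even[OF indep_lp_seq_iid_space[OF fin] p])
       (use moment[where k = 1] centered in \<open>auto simp: e_def sum_moment moment\<close>)
  have "iid_sum_moment (e n) n p \<ge> 0" for n
    unfolding sum_moment[symmetric] using p by (intro integral_nonneg_AE) (simp add: zero_le_even_power)
  moreover have "e n p \<ge> 0" for n
    unfolding e_def using p by (intro integral_nonneg_AE) (simp add: zero_le_even_power)
  moreover have "(\<lambda>n. iid_sum_moment (e n) n p) \<longlonglongrightarrow> cumulant_moment (\<lambda>k. of_bool (P k)) p"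
    using iid_sum_moment_tendsto[of e "\<lambda>k. of_bool (P k)" 0 p] lim by (simp add: e_def)
  ultimately have "(\<lambda>n. iid_sum_moment (e n) n p powr (1 / real p) /
      max (sqrt (real n * e n 2)) ((real n * e n p) powr (1 / real p))) \<longlonglongrightarrow>
      cumulant_moment (\<lambda>k. of_bool (P k)) p powr (1 / real p) / max (sqrt 1) (1 powr (1 / real p))"
    using lim[of 2] lim[of p] p \<open>P 2\<close> \<open>P p\<close>
    by (intro tendsto_divide tendsto_max tendsto_real_sqrt tendsto_powr' tendsto_const)
       (auto simp: e_def[symmetric])
  then show ?thesis
    unfolding ratio by simp
qed

section \<open>The extremal laws\<close>

definition centered_bernoulli :: "nat \<Rightarrow> real pmf" where
  "centered_bernoulli n = map_pmf (\<lambda>b. of_bool b - 1 / real n) (bernoulli_pmf (1 / real n))"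

lemma centered_bernoulli_moment:
  "measure_pmf.expectation (centered_bernoulli n) (\<lambda>x. x ^ k) =
     (1 - 1 / real n) ^ k * (1 / real n) + (- (1 / real n)) ^ k * (1 - 1 / real n)"
proof -
  have "1 / real n \<le> 1" by (cases n) auto
  then show ?thesis
    unfolding centered_bernoulli_def by simp
qed

lemma centered_bernoulli_moment_tendsto:
  assumes "1 \<le> k"
  shows "(\<lambda>n. real n * measure_pmf.expectation (centered_bernoulli n) (\<lambda>x. x ^ k)) \<longlonglongrightarrow> of_bool (k \<noteq> 1)"
proof -
  obtain j where k: "k = Suc j" using assms by (cases k) auto
  have "(\<lambda>n. 1 / real n) \<longlonglongrightarrow> 0" by real_asymp
  then have "(\<lambda>n. (1 - 1 / real n) ^ k - (- (1 / real n)) ^ j * (1 - 1 / real n)) \<longlonglongrightarrow>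
      (1 - 0) ^ k - (- 0) ^ j * (1 - 0)"
    by (intro tendsto_intros)
  moreover have "(1 - 0) ^ k - (- 0) ^ j * (1 - 0) = (of_bool (k \<noteq> 1) :: real)"
    by (simp add: k power_0_left)
  moreover have "\<forall>\<^sub>F n in sequentially. (1 - 1 / real n) ^ k - (- (1 / real n)) ^ j * (1 - 1 / real n) =
      real n * measure_pmf.expectation (centered_bernoulli n) (\<lambda>x. x ^ k)"
    using eventually_gt_at_top[of 0]
    by eventually_elim (simp add: centered_bernoulli_moment k distrib_left del: power_Suc, simp)
  ultimately show ?thesis by (auto intro: Lim_transform_eventually)
qed

text \<open>
  A random sign kept with probability \<open>1 / n\<close>. The sign is a coin of its own, so that reflection amounts
  to negating this coin.
\<close>
definition lazy_sign :: "nat \<Rightarrow> real pmf" where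
  "lazy_sign n = map_pmf (\<lambda>(b, s). if b then (if s then 1 else -1) else 0)
     (pair_pmf (bernoulli_pmf (1 / real n)) (bernoulli_pmf (1 / 2)))"

lemma lazy_sign_moment:
  assumes "1 \<le> k"
  shows "measure_pmf.expectation (lazy_sign n) (\<lambda>x. x ^ k) = of_bool (even k) / real n"
proof -
  have "1 / real n \<le> 1" by (cases n) auto
  then show ?thesis
    unfolding lazy_sign_def integral_map_pmf using assms
    by (subst integral_measure_pmf_real[of "{(True, True), (True, False)}"])
       (auto simp: pmf_pair power_0_left split: if_splits)
qed

lemma map_uminus_lazy_sign: "map_pmf uminus (lazy_sign n) = lazy_sign n"
proof -
  have half: "bernoulli_pmf (1 / 2) = map_pmf Not (bernoulli_pmf (1 / 2))"
  proof -
    have "map_pmf Not (bernoulli_pmf (1 / 2)) = pmf_of_set (Not ` UNIV)"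
      unfolding bernoulli_pmf_half_conv_pmf_of_set by (rule map_pmf_of_set_inj) (auto simp: inj_on_def)
    also have "Not ` UNIV = UNIV" by (auto simp: image_iff)
    finally show ?thesis by (simp add: bernoulli_pmf_half_conv_pmf_of_set)
  qed
  have "lazy_sign n = map_pmf (\<lambda>(b, s). if b then (if s then 1 else -1) else 0)
     (pair_pmf (bernoulli_pmf (1 / real n)) (map_pmf Not (bernoulli_pmf (1 / 2))))"
    unfolding lazy_sign_def by (subst half) (rule refl)
  also have "\<dots> = map_pmf uminus (lazy_sign n)"
    unfolding lazy_sign_def pair_map_pmf2 pmf.map_comp by (intro map_pmf_cong refl) auto
  finally show ?thesis by simp
qed

lemma symmetric_seq_iid_space:
  assumes "map_pmf uminus q = q"
  shows "symmetric_seq (iid_space q) (\<lambda>i \<omega>. \<omega> i)"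
  unfolding symmetric_seq_def
proof
  fix i
  have "distr (iid_space q) borel (\<lambda>\<omega>. - \<omega> i) = distr (distr (iid_space q) borel (\<lambda>\<omega>. \<omega> i)) borel uminus"
    by (subst distr_distr) (auto simp: o_def)
  also have "\<dots> = distr (measure_pmf q) borel uminus"
    unfolding distr_iid_space by (subst distr_distr) (auto simp: o_def)
  also have "\<dots> = distr (distr (measure_pmf q) (count_space UNIV) uminus) borel (\<lambda>x. x)"
    by (subst distr_distr) (auto simp: o_def)
  also have "\<dots> = distr (measure_pmf q) borel (\<lambda>x. x)"
    by (simp add: assms flip: map_pmf_rep_eq)
  finally show "distr (iid_space q) borel (\<lambda>\<omega>. \<omega> i) = distr (iid_space q) borel (\<lambda>\<omega>. - \<omega> i)"
    by (simp add: distr_iid_space)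
qed

section \<open>The constants for even exponents\<close>

lemma symmetric_seq_odd_moment:
  assumes "symmetric_seq M \<xi>" and [measurable]: "\<xi> i \<in> borel_measurable M" and "odd k"
  shows "(\<integral>\<omega>. \<xi> i \<omega> ^ k \<partial>M) = 0"
proof -
  have "(\<integral>\<omega>. \<xi> i \<omega> ^ k \<partial>M) = (\<integral>x. x ^ k \<partial>distr M borel (\<xi> i))"
    by (simp add: integral_distr)
  also have "\<dots> = (\<integral>x. x ^ k \<partial>distr M borel (\<lambda>\<omega>. - \<xi> i \<omega>))"
    using assms(1) by (simp add: symmetric_seq_def)
  also have "\<dots> = (\<integral>\<omega>. (- \<xi> i \<omega>) ^ k \<partial>M)"
    by (simp add: integral_distr)
  finally show ?thesis using \<open>odd k\<close> by simp
qed

theorem rosenthal_C_even: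
  assumes p: "even p" "4 \<le> p"
  shows "rosenthal_C (real p) = ereal (cumulant_moment (\<lambda>k. of_bool (k \<noteq> 1)) p powr (1 / real p))"
proof (rule antisym)
  show "rosenthal_C (real p) \<le> ereal (cumulant_moment (\<lambda>k. of_bool (k \<noteq> 1)) p powr (1 / real p))"
    unfolding rosenthal_C_def using p
    by (auto intro!: SUP_least rosenthal_ratio_le_cumulant_moment simp: centered_seq_def)
  have "(\<lambda>n. rosenthal_ratio (iid_space (centered_bernoulli n)) (real p) (\<lambda>i \<omega>. \<omega> i) n)
      \<longlonglongrightarrow> cumulant_moment (\<lambda>k. of_bool (k \<noteq> 1)) p powr (1 / real p)"
    using p centered_bernoulli_moment_tendsto centered_bernoulli_moment[of _ 1]
    by (intro rosenthal_ratio_iid_tendsto) (auto simp: centered_bernoulli_def)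
  moreover have "ereal (rosenthal_ratio (iid_space (centered_bernoulli n)) (real p) (\<lambda>i \<omega>. \<omega> i) n)
      \<le> rosenthal_C (real p)" if "n \<ge> 1" for n
  proof (rule rosenthal_ratio_le_C[OF indep_lp_seq_iid_space _ that])
    show fin: "finite (set_pmf (centered_bernoulli n))" by (simp add: centered_bernoulli_def)
    show "centered_seq (iid_space (centered_bernoulli n)) (\<lambda>i \<omega>. \<omega> i)"
      unfolding centered_seq_def
      using integral_iid_space[of "\<lambda>x. x" "centered_bernoulli n"] centered_bernoulli_moment[of n 1]
      by (auto intro: integrable_measure_pmf_finite fin)
  qed
  ultimately show "ereal (cumulant_moment (\<lambda>k. of_bool (k \<noteq> 1)) p powr (1 / real p)) \<le> rosenthal_C (real p)"
    by (intro LIMSEQ_le_const2[OF tendsto_ereal]) auto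
qed

lemma rosenthal_ratio_symmetric_le:
  assumes seq: "indep_lp_seq M (real p) \<xi>" "symmetric_seq M \<xi>" and p: "even p" "4 \<le> p"
  shows "rosenthal_ratio M (real p) \<xi> n \<le> cumulant_moment (\<lambda>k. of_bool (even k)) p powr (1 / real p)"
proof (rule rosenthal_ratio_le_cumulant_moment[OF seq(1) p])
  interpret prob_space M using seq(1) by (simp add: indep_lp_seq_def)
  have "indep_vars (\<lambda>_. borel) \<xi> UNIV"
    using seq(1) by (simp add: indep_lp_seq_def)
  then have meas: "\<xi> i \<in> borel_measurable M" for i
    by (auto simp: indep_vars_def2)
  show "(\<integral>\<omega>. \<xi> i \<omega> ^ k \<partial>M) = 0" if "odd k" for i k
    by (rule symmetric_seq_odd_moment[OF seq(2) meas that])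
  show "odd (1::nat)" by simp
qed

theorem rosenthal_S_even:
  assumes p: "even p" "4 \<le> p"
  shows "rosenthal_S (real p) = ereal (cumulant_moment (\<lambda>k. of_bool (even k)) p powr (1 / real p))"
proof (rule antisym)
  show "rosenthal_S (real p) \<le> ereal (cumulant_moment (\<lambda>k. of_bool (even k)) p powr (1 / real p))"
    unfolding rosenthal_S_def using p
    by (auto intro!: SUP_least rosenthal_ratio_symmetric_le)
  have moment_lim: "(\<lambda>n. real n * measure_pmf.expectation (lazy_sign n) (\<lambda>x. x ^ k)) \<longlonglongrightarrow> of_bool (even k)"
    if "1 \<le> k" for k
  proof -
    have "\<forall>\<^sub>F n in sequentially. of_bool (even k) = real n * measure_pmf.expectation (lazy_sign n) (\<lambda>x. x ^ k)"
      using eventually_gt_at_top[of 0] by eventually_elim (simp add: lazy_sign_moment[OF that])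
    then show ?thesis by (rule Lim_transform_eventually[OF tendsto_const])
  qed
  have fin: "finite (set_pmf (lazy_sign n))" for n by (simp add: lazy_sign_def)
  have "(\<lambda>n. rosenthal_ratio (iid_space (lazy_sign n)) (real p) (\<lambda>i \<omega>. \<omega> i) n)
      \<longlonglongrightarrow> cumulant_moment (\<lambda>k. of_bool (even k)) p powr (1 / real p)"
  proof (rule rosenthal_ratio_iid_tendsto)
    show "measure_pmf.expectation (lazy_sign n) (\<lambda>x. x) = 0" for n
      using lazy_sign_moment[of 1 n] by simp
    show "even p" "2 \<le> p" using p by auto
    show "even (2::nat)" by simp
    show "even p" by (rule p(1))
  qed (rule fin moment_lim; assumption?)+
  moreover have "ereal (rosenthal_ratio (iid_space (lazy_sign n)) (real p) (\<lambda>i \<omega>. \<omega> i) n)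
      \<le> rosenthal_S (real p)" if "n \<ge> 1" for n
    by (rule rosenthal_ratio_le_S[OF indep_lp_seq_iid_space[OF fin]
          symmetric_seq_iid_space[OF map_uminus_lazy_sign] that])
  ultimately show "ereal (cumulant_moment (\<lambda>k. of_bool (even k)) p powr (1 / real p)) \<le> rosenthal_S (real p)"
    by (intro LIMSEQ_le_const2[OF tendsto_ereal]) auto
qed

theorem theorem4:
  shows "(\<forall>m::nat. m \<ge> 2 \<longrightarrow>
      rosenthal_K (real (2 * m)) =
        ereal (\<Sum>l=0..2*m. (-1) ^ l * real ((2 * m) choose l) *
          (\<Sum>q=0..2*m-l. \<Sum>r=0..l. (1 / 2 ^ (r + q)) * real (Stirling (2 * m - l) q) * real (Stirling l r))) \<and>
      rosenthal_C (real (2 * m)) ^ (2 * m) = ereal (poisson_L (real (2 * m))) \<and>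
      poisson_L (real (2 * m)) =
        (\<Sum>l=0..2*m. (-1) ^ l * real ((2 * m) choose l) *
          (\<Sum>r=0..2*m-l. real (Stirling (2 * m - l) r)))) \<and>
    (\<forall>p::nat. odd p \<and> p \<ge> 5 \<longrightarrow>
      poisson_G (real p) ^ p = poisson_L (real p) \<and>
      poisson_L (real p) =
        2 / exp 1 + (\<Sum>k=0..p. (-1) ^ k * real (p choose k) * bell (p - k)))"
proof (intro conjI allI impI)
  have root: "(x powr (1 / real p)) ^ p = x" "(x powr (1 / real p)) powr real p = x"
    if "x \<ge> 0" "p > 0" for x :: real and p :: nat
    using that by (cases "x = 0"; simp add: powr_powr flip: powr_realpow)+
  {
    fix m :: nat assume "m \<ge> 2"
    then have p: "even (2 * m)" "4 \<le> 2 * m" "0 < 2 * m" by auto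
    have nonneg: "cumulant_moment (\<lambda>k. of_bool (P k)) (2 * m) \<ge> 0" for P
      by (intro cumulant_moment_nonneg) auto
    show "rosenthal_K (real (2 * m)) =
        ereal (\<Sum>l=0..2*m. (-1) ^ l * real ((2 * m) choose l) *
          (\<Sum>q=0..2*m-l. \<Sum>r=0..l. (1 / 2 ^ (r + q)) * real (Stirling (2 * m - l) q) * real (Stirling l r)))"
      unfolding rosenthal_K_def rosenthal_S_even[OF p(1,2)] atLeast0AtMost symmetrized_poisson_closed_form ereal_powr_def
      using root(2)[OF nonneg p(3)] by simp
    show L: "poisson_L (real (2 * m)) =
        (\<Sum>l=0..2*m. (-1) ^ l * real ((2 * m) choose l) * (\<Sum>r=0..2*m-l. real (Stirling (2 * m - l) r)))"
      unfolding atLeast0AtMost by (rule poisson_L_even[OF p(1,3)])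
    show "rosenthal_C (real (2 * m)) ^ (2 * m) = ereal (poisson_L (real (2 * m)))"
      unfolding L atLeast0AtMost centered_poisson_closed_form rosenthal_C_even[OF p(1,2)]
      using root(1)[OF nonneg p(3)] by simp
  }
  fix p :: nat assume p: "odd p \<and> p \<ge> 5"
  have "poisson_L (real p) \<ge> 0"
    unfolding poisson_L_def by (intro integral_nonneg_AE) auto
  then show "poisson_G (real p) ^ p = poisson_L (real p)"
    unfolding poisson_G_def using p by (intro root(1)) auto
  show "poisson_L (real p) = 2 / exp 1 + (\<Sum>k=0..p. (-1) ^ k * real (p choose k) * bell (p - k))"
    unfolding atLeast0AtMost using p by (intro poisson_L_odd) auto
qed

end
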